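(* Let $P_n$, $n\ge 0$, be the polynomials defined by $P_0(z)=1$, $P_1(z)=z$, $P_2(z)=z^2$, and $P_{n+1}(z)=\tfrac32 z P_n(z)-\tfrac12 P_{n-2}(z)$ for $n\ge 2$, and let $\Gamma\subset\mathbb{C}$ be the closed deltoid region defined in the context. Then for all $n\ge 0$, $$|P_n(z)|\le 1\quad\text{for all } z\in\Gamma.$$ Moreover, for all $n\ge 0$ and all $\varepsilon>0$, $$|P_n(z)|\ge \tfrac13\,(1+\sqrt{\varepsilon})^n\quad\text{for all } z\in\mathbb{C}\text{ with } |z|=1+\varepsilon.$$
   Context: The deltoid curve $\gamma\subset\mathbb{C}$ is the closed curve parameterized by $\gamma(t)=\frac23 e^{it}+\frac13 e^{-2it}$, $t\in[0,2\pi]$. The set $\Gamma$ is the closure of the region enclosed by $\gamma$ (i.e. the curve together with the bounded component of its complement). *)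

theory Defs
  imports "HOL-Analysis.Analysis" "HOL-Computational_Algebra.Polynomial"
begin

fun deltoid_poly :: "nat \<Rightarrow> complex poly" where
  "deltoid_poly 0 = 1"
| "deltoid_poly (Suc 0) = [:0, 1:]"
| "deltoid_poly (Suc (Suc 0)) = [:0, 1:] ^ 2"
| "deltoid_poly (Suc (Suc (Suc n))) = smult (3/2) ([:0, 1:] * deltoid_poly (Suc (Suc n))) - smult (1/2) (deltoid_poly n)"

definition deltoid :: "real \<Rightarrow> complex" where
  "deltoid t = 2/3 * exp (\<i> * of_real t) + 1/3 * exp (- 2 * \<i> * of_real t)"

definition deltoid_curve :: "complex set" where
  "deltoid_curve = deltoid ` {0..2*pi}"

definition deltoid_region :: "complex set" where
  "deltoid_region = closure (inside deltoid_curve)"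

lemma deltoid_eq_imp:
  assumes "deltoid s = deltoid t"
  shows "exp (\<i> * of_real s) = exp (\<i> * of_real t)"
proof (rule ccontr)
  define u v where "u = exp (\<i> * of_real s)" and "v = exp (\<i> * of_real t)"
  assume "exp (\<i> * of_real s) \<noteq> exp (\<i> * of_real t)"
  then have ne: "u \<noteq> v" by (simp add: u_def v_def)
  have nu: "norm u = 1" and nv: "norm v = 1"
    by (simp_all add: u_def v_def norm_exp_eq_Re)
  then have uz: "u \<noteq> 0" and vz: "v \<noteq> 0" by auto
  have d: "deltoid x = 2/3 * exp (\<i> * of_real x) + 1/3 * inverse ((exp (\<i> * of_real x))\<^sup>2)" for x
    by (simp add: deltoid_def exp_minus exp_double[symmetric] mult.assoc)
  have "2/3 * u + 1/3 * inverse (u\<^sup>2) = 2/3 * v + 1/3 * inverse (v\<^sup>2)"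
    using assms by (simp add: d u_def v_def)
  then have "(u - v) * (2 * (u\<^sup>2 * v\<^sup>2) - (u + v)) = 0"
    using uz vz by (simp add: field_simps power2_eq_square) algebra
  then have sum: "u + v = 2 * (u\<^sup>2 * v\<^sup>2)" using ne by auto
  have "norm (u + v) = 2"
    unfolding sum by (simp add: norm_mult norm_power nu nv)
  then have "norm (u + v) = norm u + norm v" using nu nv by simp
  then have "norm u *\<^sub>R v = norm v *\<^sub>R u" by (simp add: norm_triangle_eq)
  then show False using ne nu nv by simp
qed

lemma deltoid_region_eq:
  "deltoid_region = deltoid_curve \<union> inside deltoid_curve"
proof -
  define g where "g = (\<lambda>x. deltoid (2 * pi * x))"
  have im: "path_image g = deltoid_curve"
  proof -
    have "(\<lambda>x. 2 * pi * x) ` {0..1} = {0..2*pi}"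
      by (simp add: image_mult_atLeastAtMost)
    then show ?thesis
      unfolding path_image_def g_def deltoid_curve_def by (metis image_image)
  qed
  have "path g"
    unfolding path_def g_def deltoid_def by (intro continuous_intros)
  moreover have "x = y \<or> x = 0 \<and> y = 1 \<or> x = 1 \<and> y = 0"
    if "x \<in> {0..1}" "y \<in> {0..1}" "g x = g y" for x y
  proof -
    have "exp (\<i> * of_real (2 * pi * x)) = exp (\<i> * of_real (2 * pi * y))"
      using that(3) by (intro deltoid_eq_imp) (simp add: g_def)
    then obtain n :: int where "\<i> * of_real (2 * pi * x) = \<i> * of_real (2 * pi * y) + of_int (2 * n) * pi * \<i>"
      unfolding exp_eq by auto
    then have "Im (\<i> * of_real (2 * pi * x)) = Im (\<i> * of_real (2 * pi * y) + of_int (2 * n) * pi * \<i>)"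
      by simp
    then have "2 * pi * x = 2 * pi * (y + n)" by (simp add: algebra_simps)
    then have n: "x = y + n" by simp
    then have "- 1 \<le> n" "n \<le> 1" using that by auto
    then have "n = -1 \<or> n = 0 \<or> n = 1" by auto
    then show ?thesis using n that by auto
  qed
  ultimately have "simple_path g"
    unfolding simple_path_def loop_free_def by blast
  moreover have "deltoid (2 * pi) = deltoid 0"
  proof -
    have "exp (\<i> * of_real (2 * pi)) = 1"
      using exp_two_pi_i by (simp add: mult_ac)
    moreover have "deltoid x = 2/3 * exp (\<i> * of_real x) + 1/3 * inverse ((exp (\<i> * of_real x))\<^sup>2)" for x
      by (simp add: deltoid_def exp_minus exp_double[symmetric] mult.assoc)
    ultimately show ?thesis by simp
  qed
  then have "pathfinish g = pathstart g"
    by (simp add: g_def pathfinish_def pathstart_def)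
  ultimately have "frontier (inside deltoid_curve) = deltoid_curve"
    using Jordan_inside_outside[of g] by (simp add: im)
  then show ?thesis
    unfolding deltoid_region_def by (simp add: closure_Un_frontier Un_commute)
qed

end

theory Submission
  imports Defs "HOL-Complex_Analysis.Conformal_Mappings"
begin

text \<open>
  Substituting \<open>z = 2/3 u + 1/3 u\<^sup>-\<^sup>2\<close> and \<open>w = u\<^sup>-\<^sup>3\<close> gives \<open>P\<^sub>n(z) = u\<^sup>n h\<^sub>n(w)\<close>. As \<open>u\<close> is a root of
  the characteristic polynomial of the recurrence, the order can be lowered by one:
  \<open>h\<^sub>n\<^sub>+\<^sub>2 = w/2 (h\<^sub>n\<^sub>+\<^sub>1 + h\<^sub>n) + (1 - w)(8 + w)/18\<close>. From this form, \<open>h\<^sub>n\<close> has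
  nonnegative coefficients with sum \<open>1\<close> and constant term at least \<open>4/9\<close>.
  On the deltoid \<open>u\<close> and \<open>w\<close> have modulus one, so \<open>P\<^sub>n\<close> is bounded by \<open>1\<close> there, and inside by the
  maximum modulus principle. For real \<open>u \<ge> 1\<close> we get \<open>P\<^sub>n(y) \<ge> 4/9 u\<^sup>n\<close>, where
  \<open>y = 2/3 u + 1/3 u\<^sup>-\<^sup>2\<close>. This carries over to complex \<open>z\<close> with \<open>\<bar>z\<bar> \<ge> y\<close>, because the recurrence
  makes \<open>\<bar>P\<^sub>n(z)\<bar> / P\<^sub>n(y)\<close> nondecreasing in \<open>n\<close>. With \<open>u = 1 + \<surd>\<epsilon>\<close> one has \<open>y \<le> 1 + \<epsilon>\<close>.
\<close>

section \<open>Reduced polynomials and the signs of their coefficients\<close>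

fun reduced_poly :: "nat \<Rightarrow> real poly" where
  "reduced_poly 0 = 1"
| "reduced_poly (Suc 0) = [:2/3, 1/3:]"
| "reduced_poly (Suc (Suc n)) =
     [:0, 1/2:] * (reduced_poly (Suc n) + reduced_poly n) + [:4/9, -7/18, -1/18:]"

text \<open>The coefficients stay real so that their signs make sense; only the evaluation point is
  complex.\<close>

definition complex_poly :: "real poly \<Rightarrow> complex \<Rightarrow> complex" where
  "complex_poly p w = poly (map_poly of_real p) w"

lemma complex_poly_altdef: "complex_poly p w = (\<Sum>i\<le>degree p. of_real (coeff p i) * w ^ i)"
  unfolding complex_poly_def by (simp add: poly_altdef degree_map_poly coeff_map_poly)

lemma complex_poly_of_real: "complex_poly p (of_real x) = of_real (poly p x)"
  by (simp add: complex_poly_altdef poly_altdef)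

lemma norm_complex_poly_le:
  assumes "\<And>k. coeff p k \<ge> 0"
  shows "norm (complex_poly p w) \<le> poly p (norm w)"
  unfolding complex_poly_altdef poly_altdef
  by (rule order_trans[OF norm_sum]) (simp add: norm_mult norm_power assms)

lemma poly_ge_coeff_0:
  fixes p :: "real poly"
  assumes "\<And>k. coeff p k \<ge> 0" "x \<ge> 0"
  shows "coeff p 0 \<le> poly p x"
proof -
  have "(\<Sum>i\<in>{0}. coeff p i * x ^ i) \<le> (\<Sum>i\<le>degree p. coeff p i * x ^ i)"
    using assms by (intro sum_mono2) auto
  then show ?thesis by (simp add: poly_altdef)
qed

lemma coeff_0_reduced_poly: "coeff (reduced_poly n) 0 \<ge> 4/9"
  by (induction n rule: reduced_poly.induct) auto

text \<open>The constant is 4/9 - 7/18: an average of two constant terms plus the linear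
  inhomogeneous coefficient. It is exactly what offsets the -1/18 in degree two.\<close>

lemma coeff_1_reduced_poly: "n \<ge> 1 \<Longrightarrow> coeff (reduced_poly n) (Suc 0) \<ge> 1/18"
proof (induction n rule: reduced_poly.induct)
  case (3 n)
  show ?case
    using coeff_0_reduced_poly[of n] coeff_0_reduced_poly[of "Suc n"] by simp
qed auto

lemma coeff_reduced_poly_nonneg: "coeff (reduced_poly n) k \<ge> 0"
proof (induction n arbitrary: k rule: reduced_poly.induct)
  case 1
  show ?case by (cases k) auto
next
  case 2
  show ?case by (auto simp: coeff_pCons split: nat.split)
next
  case (3 n)
  have "k = 0 \<or> k = 1 \<or> k = 2 \<or> k = (k - 3) + 3" by arith
  then consider "k = 0" | "k = 1" | "k = 2" | j where "k = j + 3" by blast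
  then show ?case
  proof cases
    case 1
    then show ?thesis by simp
  next
    case 2
    then show ?thesis
      using coeff_1_reduced_poly[of "Suc (Suc n)"] by simp
  next
    case k: 3
    show ?thesis
    \<comment> \<open>\<open>reduced_poly 0\<close> has no linear term, so the bound 1/18 fails for
      it; here the coefficient is computed directly.\<close>
    proof (cases "n = 0")
      case True
      then show ?thesis using k by (simp add: numeral_2_eq_2)
    next
      case False
      then have "1/18 \<le> coeff (reduced_poly n) 1" "1/18 \<le> coeff (reduced_poly (Suc n)) 1"
        unfolding One_nat_def by (intro coeff_1_reduced_poly; simp)+
      moreover have "coeff (reduced_poly (Suc (Suc n))) 2 =
          (coeff (reduced_poly (Suc n)) 1 + coeff (reduced_poly n) 1) / 2 - 1/18"
        by (simp add: numeral_2_eq_2)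
      moreover have "0 \<le> (a + b) / 2 - 1/18" if "1/18 \<le> a" "1/18 \<le> b" for a b :: real
        using that by simp
      ultimately show ?thesis unfolding k by metis
    qed
  next
    case 4
    then show ?thesis using "3.IH" by (simp add: numeral_3_eq_3)
  qed
qed

text \<open>The inhomogeneous term has the factor 1 - w and vanishes at 1, leaving the average of
  the two previous values.\<close>

lemma poly_reduced_poly_1: "poly (reduced_poly n) 1 = 1"
  by (induction n rule: reduced_poly.induct) auto

lemma poly_reduced_poly_ge:
  assumes "x \<ge> 0"
  shows "poly (reduced_poly n) x \<ge> 4/9"
  using poly_ge_coeff_0[OF coeff_reduced_poly_nonneg assms] coeff_0_reduced_poly[of n]
  by (rule order_trans[rotated])

lemma norm_complex_poly_reduced_poly_le:
  assumes "norm w = 1"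
  shows "norm (complex_poly (reduced_poly n) w) \<le> 1"
  using norm_complex_poly_le[OF coeff_reduced_poly_nonneg, of n w] assms
  by (simp add: poly_reduced_poly_1)

section \<open>Substitution into the deltoid recurrence\<close>

lemma complex_poly_add: "complex_poly (p + q) w = complex_poly p w + complex_poly q w"
proof -
  have "map_poly of_real (p + q) = map_poly of_real p + (map_poly of_real q :: complex poly)"
    by (intro poly_eqI) (simp add: coeff_map_poly)
  then show ?thesis by (simp add: complex_poly_def)
qed

lemma complex_poly_pCons: "complex_poly (pCons a p) w = of_real a + w * complex_poly p w"
  by (simp add: complex_poly_def map_poly_pCons)

lemma complex_poly_reduced_poly:
  "complex_poly (reduced_poly 0) w = 1"
  "complex_poly (reduced_poly (Suc 0)) w = (2 + w) / 3"
  "complex_poly (reduced_poly (Suc (Suc n))) w =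
     w / 2 * (complex_poly (reduced_poly (Suc n)) w + complex_poly (reduced_poly n) w) +
     (1 - w) * (8 + w) / 18"
proof -
  have [simp]: "complex_poly 0 w = 0" for w by (simp add: complex_poly_def)
  have smult: "complex_poly (smult a p) w = of_real a * complex_poly p w" for a p
    by (simp add: complex_poly_def map_poly_smult)
  show "complex_poly (reduced_poly 0) w = 1"
    by (simp add: complex_poly_def)
  show "complex_poly (reduced_poly (Suc 0)) w = (2 + w) / 3"
    by (simp add: complex_poly_pCons field_simps)
  show "complex_poly (reduced_poly (Suc (Suc n))) w =
     w / 2 * (complex_poly (reduced_poly (Suc n)) w + complex_poly (reduced_poly n) w) +
     (1 - w) * (8 + w) / 18"
    by (simp add: complex_poly_add complex_poly_pCons smult field_simps)
qed

text \<open>Subtracting consecutive instances of the second-order recurrence cancels the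
  inhomogeneous term.\<close>

lemma reduced_poly_third_order:
  "complex_poly (reduced_poly (Suc (Suc (Suc n)))) w =
     (1 + w / 2) * complex_poly (reduced_poly (Suc (Suc n))) w - w / 2 * complex_poly (reduced_poly n) w"
proof -
  let ?h = "\<lambda>k. complex_poly (reduced_poly k) w"
  have "?h (Suc (Suc (Suc n))) - ?h (Suc (Suc n)) = w / 2 * (?h (Suc (Suc n)) - ?h n)"
    unfolding complex_poly_reduced_poly(3)[of "Suc n"] complex_poly_reduced_poly(3)[of n]
    by (simp add: algebra_simps del: reduced_poly.simps)
  then have "?h (Suc (Suc (Suc n))) = w / 2 * (?h (Suc (Suc n)) - ?h n) + ?h (Suc (Suc n))"
    unfolding diff_eq_eq .
  also have "\<dots> = (1 + w / 2) * ?h (Suc (Suc n)) - w / 2 * ?h n"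
    by (simp add: algebra_simps del: reduced_poly.simps)
  finally show ?thesis .
qed

lemma poly_deltoid_poly:
  assumes "u \<noteq> 0"
  shows "poly (deltoid_poly n) (2/3 * u + 1/3 * inverse (u\<^sup>2)) =
           u ^ n * complex_poly (reduced_poly n) (inverse (u ^ 3))"
proof -
  define w where "w = inverse (u ^ 3)"
  have w: "u ^ 3 * w = 1" using assms by (simp add: w_def)
  have z: "2/3 * u + 1/3 * inverse (u\<^sup>2) = u * (2 + w) / 3"
    using assms by (simp add: w_def field_simps eval_nat_numeral)
  show ?thesis unfolding z w_def[symmetric]
  proof (induction n rule: deltoid_poly.induct)
    case (4 n)
    let ?h = "\<lambda>k. complex_poly (reduced_poly k) w"
    have "poly (deltoid_poly (Suc (Suc (Suc n)))) (u * (2 + w) / 3) =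
        3/2 * (u * (2 + w) / 3) * (u ^ Suc (Suc n) * ?h (Suc (Suc n))) - 1/2 * (u ^ n * ?h n)"
      by (simp only: deltoid_poly.simps poly_diff poly_smult poly_mult poly_pCons poly_0 4) simp
    \<comment> \<open>The factor \<open>u ^ 3 * w\<close> is 1; inserting it raises
      \<open>u ^ n\<close> to the common power \<open>u ^ (n + 3)\<close>.\<close>
    also have "\<dots> = u ^ (n + 3) * ((1 + w/2) * ?h (Suc (Suc n))) - (u ^ 3 * w) / 2 * (u ^ n * ?h n)"
      unfolding w by (simp add: field_simps eval_nat_numeral del: reduced_poly.simps)
    also have "\<dots> = u ^ Suc (Suc (Suc n)) * ?h (Suc (Suc (Suc n)))"
      unfolding reduced_poly_third_order by (simp add: algebra_simps eval_nat_numeral del: reduced_poly.simps)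
    finally show ?case .
  next
    case 3
    have "complex_poly (reduced_poly (Suc (Suc 0))) w = ((2 + w) / 3) ^ 2"
      unfolding complex_poly_reduced_poly by (simp add: field_simps power2_eq_square)
    then show ?case by (simp add: power2_eq_square del: reduced_poly.simps)
  qed (simp_all add: complex_poly_reduced_poly del: reduced_poly.simps)
qed

section \<open>Upper bound on the deltoid region\<close>

lemma norm_poly_deltoid_curve:
  assumes "z \<in> deltoid_curve"
  shows "norm (poly (deltoid_poly n) z) \<le> 1"
proof -
  obtain t where z: "z = deltoid t"
    using assms unfolding deltoid_curve_def by auto
  define u where "u = exp (\<i> * of_real t)"
  have u: "norm u = 1" "u \<noteq> 0"
    by (simp_all add: u_def norm_exp_eq_Re)
  have "z = 2/3 * u + 1/3 * inverse (u\<^sup>2)"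
    by (simp add: z u_def deltoid_def exp_minus exp_double[symmetric] mult.assoc)
  moreover have "norm (complex_poly (reduced_poly n) (inverse (u ^ 3))) \<le> 1"
    by (rule norm_complex_poly_reduced_poly_le) (simp add: norm_inverse norm_power u)
  ultimately show ?thesis
    unfolding \<open>z = 2/3 * u + _\<close> poly_deltoid_poly[OF u(2)] by (simp add: u norm_mult norm_power)
qed

lemma norm_poly_deltoid_region:
  assumes "z \<in> deltoid_region"
  shows "norm (poly (deltoid_poly n) z) \<le> 1"
proof (cases "z \<in> deltoid_curve")
  case True
  then show ?thesis by (rule norm_poly_deltoid_curve)
next
  case False
  then have z: "z \<in> inside deltoid_curve"
    using assms by (simp add: deltoid_region_eq)
  have "compact deltoid_curve"
    unfolding deltoid_curve_def deltoid_def
    by (intro compact_continuous_image continuous_intros) auto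
  then have inside: "frontier (inside deltoid_curve) \<subseteq> deltoid_curve" "bounded (inside deltoid_curve)"
    by (simp_all add: frontier_inside_subset compact_imp_closed bounded_inside compact_imp_bounded)
  show ?thesis
  proof (rule maximum_modulus_frontier[OF _ _ inside(2) _ z])
    show "poly (deltoid_poly n) holomorphic_on interior (inside deltoid_curve)"
      by (intro holomorphic_intros)
    show "continuous_on (closure (inside deltoid_curve)) (poly (deltoid_poly n))"
      by (intro continuous_intros)
    show "norm (poly (deltoid_poly n) x) \<le> 1" if "x \<in> frontier (inside deltoid_curve)" for x
      using inside(1) that by (intro norm_poly_deltoid_curve) blast
  qed
qed

section \<open>Lower bound by comparison with a positive real point\<close>

lemma poly_deltoid_poly_real:
  fixes u :: real
  assumes "u > 0"
  shows "poly (deltoid_poly n) (of_real (2/3 * u + 1/3 * inverse (u\<^sup>2))) =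
           of_real (u ^ n * poly (reduced_poly n) (inverse (u ^ 3)))"
  using poly_deltoid_poly[of "of_real u" n] assms
    complex_poly_of_real[of "reduced_poly n" "inverse (u ^ 3)"] by simp

lemma norm_poly_deltoid_poly_ge:
  fixes y :: real and b :: "nat \<Rightarrow> real"
  assumes "y \<le> norm z" "y > 0"
    and b: "\<And>n. poly (deltoid_poly n) (of_real y) = of_real (b n)"
    and pos: "\<And>n. b n > 0"
  shows "b n \<le> norm (poly (deltoid_poly n) z)"
proof -
  define a where "a n = norm (poly (deltoid_poly n) z)" for n
  define t where "t n = a n / b n" for n
  have a: "a n = t n * b n" for n
    using pos[of n] by (simp add: t_def)
  have b0: "b 0 = 1" using b[of 0] by simp
  have b1: "b (Suc 0) = y" using b[of "Suc 0"] by simp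
  have b2: "b (Suc (Suc 0)) = y\<^sup>2"
    using b[of "Suc (Suc 0)"] by (simp add: power2_eq_square flip: of_real_mult)
  have b3: "b (n + 3) = 3/2 * y * b (n + 2) - 1/2 * b n" for n
  proof -
    have "complex_of_real (b (n + 3)) = of_real (3/2 * y * b (n + 2) - 1/2 * b n)"
      using b[of n] b[of "Suc (Suc n)"] b[of "Suc (Suc (Suc n))"]
      by (simp add: eval_nat_numeral algebra_simps)
    then show ?thesis unfolding of_real_eq_iff .
  qed
  have a3: "a (n + 3) \<ge> 3/2 * norm z * a (n + 2) - 1/2 * a n" for n
    using norm_triangle_ineq2[of "3/2 * z * poly (deltoid_poly (n + 2)) z"
        "1/2 * poly (deltoid_poly n) z"]
    by (simp add: a_def norm_mult eval_nat_numeral mult_ac)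
  \<comment> \<open>Two inequalities are carried along because the subtracted term lies three
    indices back: the step needs \<open>t n \<le> t (n + 2)\<close>.\<close>
  have mono: "t n \<le> t (Suc n) \<and> t (Suc n) \<le> t (Suc (Suc n))" for n
  proof (induction n)
    case 0
    then show ?case using assms(1,2)
      by (simp add: t_def a_def b0 b1 b2 norm_mult norm_power power2_eq_square divide_simps mult_mono)
  next
    case (Suc n)
    have "t (n + 2) * b (n + 3) = 3/2 * y * (t (n + 2) * b (n + 2)) - 1/2 * (t (n + 2) * b n)"
      unfolding b3 by (simp add: algebra_simps)
    also have "\<dots> \<le> 3/2 * norm z * a (n + 2) - 1/2 * a n"
    proof (intro diff_mono mult_left_mono)
      show "a n \<le> t (n + 2) * b n"
        using Suc pos[of n] unfolding a by simp
      show "3/2 * y * (t (n + 2) * b (n + 2)) \<le> 3/2 * norm z * a (n + 2)"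
        unfolding a[symmetric] using assms(1) by (simp add: a_def mult_right_mono)
    qed simp
    also have "\<dots> \<le> t (n + 3) * b (n + 3)"
      using a3 unfolding a[symmetric] .
    finally have "t (n + 2) \<le> t (n + 3)" using pos[of "n + 3"] by simp
    then show ?case using Suc by (simp add: eval_nat_numeral)
  qed
  then have "incseq t" by (simp add: incseq_SucI)
  then have "t 0 \<le> t n" by (simp add: incseqD)
  moreover have "t 0 = 1" by (simp add: t_def a_def b0)
  ultimately show ?thesis
    using pos[of n] by (simp add: t_def a_def)
qed

theorem theorem2:
  shows "(\<forall>n. \<forall>z\<in>deltoid_region. cmod (poly (deltoid_poly n) z) \<le> 1) \<and>
    (\<forall>n. \<forall>\<epsilon>::real. \<epsilon> > 0 \<longrightarrow>
      (\<forall>z::complex. cmod z = 1 + \<epsilon> \<longrightarrow>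
        cmod (poly (deltoid_poly n) z) \<ge> 1/3 * (1 + sqrt \<epsilon>) ^ n))"
proof (intro conjI allI ballI impI)
  fix n z
  assume "z \<in> deltoid_region"
  then show "cmod (poly (deltoid_poly n) z) \<le> 1" by (rule norm_poly_deltoid_region)
next
  fix n and \<epsilon> :: real and z :: complex
  assume \<epsilon>: "\<epsilon> > 0" and z: "cmod z = 1 + \<epsilon>"
  define s where "s = sqrt \<epsilon>"
  define u where "u = 1 + s"
  define y where "y = 2/3 * u + 1/3 * inverse (u\<^sup>2)"
  have s: "s > 0" "s\<^sup>2 = \<epsilon>" using \<epsilon> by (simp_all add: s_def)
  then have u: "u > 0" by (simp add: u_def)
  have "y > 0" using u by (simp add: y_def add_pos_pos)
  \<comment> \<open>As a function of \<open>s\<close>, \<open>y\<close> has the Taylor expansion 1 +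
    s^2 + O(s^3) at 0, hence the factor \<open>s ^ 3\<close>.\<close>
  have "1 + s\<^sup>2 - y = s ^ 3 * (4 + 3 * s) / (3 * u\<^sup>2)"
    using u unfolding y_def by (simp add: divide_simps) (simp add: u_def algebra_simps eval_nat_numeral)
  also have "\<dots> \<ge> 0" using s(1) by simp
  finally have "y \<le> cmod z" using s(2) z by simp
  define b where "b n = u ^ n * poly (reduced_poly n) (inverse (u ^ 3))" for n
  have b: "poly (deltoid_poly n) (of_real y) = of_real (b n)" "b n \<ge> 4/9 * u ^ n" for n
    using poly_deltoid_poly_real[OF u] poly_reduced_poly_ge[of "inverse (u ^ 3)" n] u
    by (simp_all add: b_def y_def mult.commute mult_left_mono)
  have "b n > 0" for n
    using b(2)[of n] zero_less_power[OF u, of n] by linarith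
  then have "b n \<le> cmod (poly (deltoid_poly n) z)"
    using \<open>y \<le> cmod z\<close> \<open>y > 0\<close> b(1) by (intro norm_poly_deltoid_poly_ge)
  moreover have "1/3 * u ^ n \<le> 4/9 * u ^ n" using u by simp
  ultimately show "cmod (poly (deltoid_poly n) z) \<ge> 1/3 * (1 + sqrt \<epsilon>) ^ n"
    using b(2)[of n] unfolding u_def s_def by linarith
qed

end
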